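(* (AMDCT VII) Let $n,N$ be positive integers and $\rho=\left(\frac12,\dots,\frac12\right)\in\mathbb{R}^n$. For all $k,k'\in D_N^-$, $$\sum_{s\in F_N^{\mathrm{VII},-}}\varepsilon_s\cos_{k+\rho}^-(s)\cos_{k'+\rho}^-(s)=\widetilde{d}_k^{\,-1}\left(\frac{2N-1}{4}\right)^n\delta_{kk'}.$$ Consequently any function $f:F_N^{\mathrm{VII},-}\to\mathbb{R}$ can be expanded, for all $s\in F_N^{\mathrm{VII},-}$, as $$f(s)=\sum_{k\in D_N^-}A_k\cos^-_{k+\rho}(s)\quad\text{with}\quad A_k=\widetilde{d}_k\left(\frac{4}{2N-1}\right)^n\sum_{s\in F_N^{\mathrm{VII},-}}\varepsilon_s f(s)\cos_{k+\rho}^-(s).$$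
   Context: For $\lambda,x\in\mathbb{R}^n$, the antisymmetric cosine function is $\cos^-_\lambda(x)=\sum_{\sigma\in S_n}\mathrm{sgn}(\sigma)\prod_{i=1}^n\cos(\pi\lambda_{\sigma(i)}x_i)$. For fixed $N$, put $c_r=\frac12$ if $r=0$ or $r=N$, and $c_r=1$ otherwise. Let $D_N=\{(k_1,\dots,k_n)\in\mathbb{Z}^n : 0\le k_i\le N-1,\ i=1,\dots,n\}$ and $D_N^-=\{k\in D_N : k_1>k_2>\dots>k_n\}$. For $k\in D_N$, $\widetilde{d}_k=c_{k_1+1}\cdots c_{k_n+1}$. The grid is $F_N^{\mathrm{VII},-}=\left\{\left(\frac{2r_1}{2N-1},\dots,\frac{2r_n}{2N-1}\right) : (r_1,\dots,r_n)\in D_N^-\right\}$, and for $s=\left(\frac{2r_1}{2N-1},\dots,\frac{2r_n}{2N-1}\right)$ in it, $\varepsilon_s=c_{r_1}\cdots c_{r_n}$. *)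

theory Defs
  imports Complex_Main "HOL-Library.FuncSet" "HOL-Combinatorics.Permutations"
begin

text \<open>
  A vector \<open>(v\<^sub>1, \<dots>, v\<^sub>n)\<close> is a function on \<open>nat\<close> read on the index set \<open>{1..n}\<close>. The index sets
  and the grid below consist of extensional functions (equal to \<open>undefined\<close> outside \<open>{1..n}\<close>),
  so that \<open>k = k'\<close> is equality of \<open>n\<close>-tuples and no tuple occurs twice in a sum.
\<close>

definition cos_minus :: "nat \<Rightarrow> (nat \<Rightarrow> real) \<Rightarrow> (nat \<Rightarrow> real) \<Rightarrow> real" where
  "cos_minus n l x =
     (\<Sum>p | p permutes {1..n}. of_int (sign p) * (\<Prod>i=1..n. cos (pi * l (p i) * x i)))"

definition c :: "nat \<Rightarrow> int \<Rightarrow> real" where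
  "c N r = (if r = 0 \<or> r = int N then 1 / 2 else 1)"

definition D :: "nat \<Rightarrow> nat \<Rightarrow> (nat \<Rightarrow> int) set" where
  "D n N = {1..n} \<rightarrow>\<^sub>E {0..int N - 1}"

definition D_minus :: "nat \<Rightarrow> nat \<Rightarrow> (nat \<Rightarrow> int) set" where
  "D_minus n N = {k \<in> D n N. \<forall>i\<in>{1..n}. \<forall>j\<in>{1..n}. i < j \<longrightarrow> k i > k j}"

definition d_tilde :: "nat \<Rightarrow> nat \<Rightarrow> (nat \<Rightarrow> int) \<Rightarrow> real" where
  "d_tilde n N k = (\<Prod>i=1..n. c N (k i + 1))"

definition grid_point :: "nat \<Rightarrow> nat \<Rightarrow> (nat \<Rightarrow> int) \<Rightarrow> (nat \<Rightarrow> real)" where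
  "grid_point n N r = (\<lambda>i\<in>{1..n}. 2 * of_int (r i) / (2 * real N - 1))"

definition F_VII_minus :: "nat \<Rightarrow> nat \<Rightarrow> (nat \<Rightarrow> real) set" where
  "F_VII_minus n N = grid_point n N ` D_minus n N"

text \<open>The weight \<open>\<epsilon>\<^sub>s\<close> is a function of the grid point \<open>s\<close>; the label \<open>r\<close> of \<open>s\<close> is unique, and
  \<open>grid_weight_grid_point\<close> below recovers the product formula in terms of \<open>r\<close>.\<close>

definition grid_weight :: "nat \<Rightarrow> nat \<Rightarrow> (nat \<Rightarrow> real) \<Rightarrow> real" where
  "grid_weight n N s =
     (let r = (THE r. r \<in> D_minus n N \<and> s = grid_point n N r) in \<Prod>i=1..n. c N (r i))"

definition \<rho> :: "nat \<Rightarrow> nat \<Rightarrow> real" where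
  "\<rho> n = (\<lambda>i\<in>{1..n}. 1 / 2)"

definition plus_rho :: "nat \<Rightarrow> (nat \<Rightarrow> int) \<Rightarrow> (nat \<Rightarrow> real)" where
  "plus_rho n k = (\<lambda>i\<in>{1..n}. of_int (k i) + \<rho> n i)"

definition amdct_coeff :: "nat \<Rightarrow> nat \<Rightarrow> ((nat \<Rightarrow> real) \<Rightarrow> real) \<Rightarrow> (nat \<Rightarrow> int) \<Rightarrow> real" where
  "amdct_coeff n N f k =
     d_tilde n N k * (4 / (2 * real N - 1)) ^ n *
     (\<Sum>s\<in>F_VII_minus n N. grid_weight n N s * f s * cos_minus n (plus_rho n k) s)"

lemma inj_on_grid_point: "inj_on (grid_point n N) (D_minus n N)"
proof (rule inj_onI)
  fix r r' assume r: "r \<in> D_minus n N" and r': "r' \<in> D_minus n N"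
    and eq: "grid_point n N r = grid_point n N r'"
  have nz: "2 * real N - 1 \<noteq> 0"
  proof
    assume "2 * real N - 1 = 0"
    then have "real (2 * N) = real 1" by simp
    then have "2 * N = 1" by (simp only: of_nat_eq_iff)
    then show False by presburger
  qed
  have "r i = r' i" if "i \<in> {1..n}" for i
    using fun_cong[OF eq, of i] that nz by (simp add: grid_point_def)
  with r r' show "r = r'"
    unfolding D_minus_def D_def by (auto intro: PiE_ext)
qed

lemma grid_weight_grid_point:
  assumes "r \<in> D_minus n N"
  shows "grid_weight n N (grid_point n N r) = (\<Prod>i=1..n. c N (r i))"
proof -
  have "(THE r'. r' \<in> D_minus n N \<and> grid_point n N r = grid_point n N r') = r"
    using assms inj_on_grid_point[of n N] by (auto simp: inj_on_def)
  then show ?thesis by (simp add: grid_weight_def)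
qed

lemma finite_D_minus: "finite (D_minus n N)"
  unfolding D_minus_def D_def by (simp add: finite_PiE)

lemma finite_F_VII_minus: "finite (F_VII_minus n N)"
  unfolding F_VII_minus_def using finite_D_minus by simp

end

theory Submission
  imports Defs
begin

text \<open>
  At a grid point labelled by \<open>r\<close>, the function \<open>cos_minus n (plus_rho n k)\<close> is the determinant of
  the matrix with entries \<open>E (k i) (r j)\<close>, where \<open>E a b = cos (\<pi> (a + 1/2) 2b / (2N - 1))\<close> is the
  kernel of the one-dimensional transform. A weighted sum over strictly decreasing \<open>r\<close> of a product of
  two such determinants is, by the Cauchy--Binet formula (\<open>cauchy_binet_alternant\<close>), the single
  determinant formed from the one-dimensional Gram matrix \<open>G a b = (\<Sum>t. w t * E a t * E b t)\<close>.
  If \<open>G\<close> is diagonal, a term of the determinant at strictly decreasing \<open>k\<close> and \<open>l\<close> survives only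
  when a permutation turns one into the other, which forces \<open>k = l\<close> and the identity permutation.
  So one-dimensional orthogonality passes to the antisymmetric functions (\<open>alternant_orthogonal\<close>).

  The one-dimensional kernel is orthogonal both in the frequency, summing over points with weights
  \<open>c N r\<close>, and in the point, summing over frequencies with weights \<open>c N (k + 1)\<close>
  (\<open>cosine_kernel_orthogonal_frequencies\<close>, \<open>cosine_kernel_orthogonal_points\<close>); either way the product
  of cosines becomes a sum of two cosines, and the resulting sums are Dirichlet kernels that telescope
  after multiplication by the sine of the half angle. The first orthogonality gives the discrete
  orthogonality of the antisymmetric cosines. The second gives their completeness: inserting the
  definition of the coefficients into the expansion and interchanging the sums leaves only \<open>f s\<close>.
\<close>

section \<open>Alternants\<close>

text \<open>
  This is the determinant of the matrix with entry \<open>E (k i) (r j)\<close> in row \<open>i\<close> and column \<open>j\<close>. Keeping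
  the kernel apart from the two labellings lets permutations act on a labelling, and lets the roles of
  frequencies and points be exchanged by transposing the kernel.
\<close>

definition alternant :: "nat \<Rightarrow> ('a \<Rightarrow> 'b \<Rightarrow> real) \<Rightarrow> (nat \<Rightarrow> 'a) \<Rightarrow> (nat \<Rightarrow> 'b) \<Rightarrow> real" where
  "alternant n E k r =
     (\<Sum>p | p permutes {1..n}. of_int (sign p) * (\<Prod>i=1..n. E (k (p i)) (r i)))"

lemma alternant_cong:
  assumes "\<And>i j. i \<in> {1..n} \<Longrightarrow> j \<in> {1..n} \<Longrightarrow> E (k i) (r j) = E' (k' i) (r' j)"
  shows "alternant n E k r = alternant n E' k' r'"
  unfolding alternant_def
proof (intro sum.cong refl arg_cong2[where f="(*)"] prod.cong, goal_cases)
  case (1 p i)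
  then have "p i \<in> {1..n}" using permutes_in_image[of p "{1..n}" i] by simp
  with 1 show ?case using assms by simp
qed

lemma permutation_interval: "p permutes {1..n::nat} \<Longrightarrow> permutation p"
  by (rule permutes_imp_permutation) simp_all

lemma alternant_transpose:
  "alternant n (\<lambda>a b. E b a) r k = alternant n E k r"
proof -
  have "of_int (sign p) * (\<Prod>i=1..n. E (k i) (r (p i)))
      = of_int (sign (inv p)) * (\<Prod>i=1..n. E (k (inv p i)) (r i))"
    if p: "p permutes {1..n}" for p
  proof -
    have "(\<Prod>i=1..n. E (k (inv p i)) (r i)) = (\<Prod>i=1..n. E (k (inv p (p i))) (r (p i)))"
      using prod.permute[OF p, of "\<lambda>i. E (k (inv p i)) (r i)"] by (simp add: o_def)
    then show ?thesis
      using permutes_inverses[OF p] sign_inverse[OF permutation_interval[OF p]] by simp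
  qed
  then show ?thesis
    unfolding alternant_def
    by (subst (2) sum_permutations_inverse) (auto intro!: sum.cong)
qed

lemma alternant_permute_rows:
  assumes q: "q permutes {1..n}"
  shows "alternant n E (k \<circ> q) r = of_int (sign q) * alternant n E k r"
proof -
  have "of_int (sign p) * (\<Prod>i=1..n. E ((k \<circ> q) (p i)) (r i))
      = of_int (sign q) * (of_int (sign (q \<circ> p)) * (\<Prod>i=1..n. E (k ((q \<circ> p) i)) (r i)))"
    if p: "p permutes {1..n}" for p
  proof -
    have "(of_int (sign q) :: real) * of_int (sign (q \<circ> p)) = of_int (sign p)"
      using sign_compose[OF permutation_interval[OF q] permutation_interval[OF p]]
      by (simp flip: of_int_mult)
    then show ?thesis
      by (simp add: o_def flip: mult.assoc)
  qed
  then show ?thesis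
    unfolding alternant_def
    by (subst (2) setum_permutations_compose_left[OF q])
       (auto simp: sum_distrib_left intro!: sum.cong)
qed

lemma alternant_permute_columns:
  assumes "q permutes {1..n}"
  shows "alternant n E k (r \<circ> q) = of_int (sign q) * alternant n E k r"
  using alternant_permute_rows[OF assms, of "\<lambda>a b. E b a" r k]
  by (simp add: alternant_transpose[of n E])

text \<open>Exchanging the two equal columns changes the sign but not the tuple.\<close>

lemma alternant_repeated_column:
  assumes "\<not> inj_on r {1..n}"
  shows "alternant n E k r = 0"
proof -
  obtain i j where ij: "i \<in> {1..n}" "j \<in> {1..n}" "i \<noteq> j" "r i = r j"
    using assms by (auto simp: inj_on_def)
  let ?q = "Transposition.transpose i j"
  have "?q permutes {1..n}" using ij by (intro permutes_swap_id)
  moreover have "r \<circ> ?q = r" using ij by (auto simp: Transposition.transpose_def)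
  ultimately have "alternant n E k r = of_int (sign ?q) * alternant n E k r"
    using alternant_permute_columns[of ?q n E k r] by simp
  with ij show ?thesis by (simp add: sign_swap_id)
qed

section \<open>Strictly decreasing tuples\<close>

definition decreasing_tuples :: "nat \<Rightarrow> 'a::linorder set \<Rightarrow> (nat \<Rightarrow> 'a) set" where
  "decreasing_tuples n X =
     {k \<in> {1..n} \<rightarrow>\<^sub>E X. \<forall>i\<in>{1..n}. \<forall>j\<in>{1..n}. i < j \<longrightarrow> k i > k j}"

lemma decreasing_tuples_less_iff:
  assumes "k \<in> decreasing_tuples n X" "i \<in> {1..n}" "j \<in> {1..n}"
  shows "k i > k j \<longleftrightarrow> i < j"
  using assms unfolding decreasing_tuples_def
  by (cases i j rule: linorder_cases) (auto dest: order.asym)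

lemma decreasing_tuples_inj_on:
  "k \<in> decreasing_tuples n X \<Longrightarrow> inj_on k {1..n}"
  unfolding decreasing_tuples_def
  by (intro linorder_inj_onI) (auto simp: neq_iff)

lemma increasing_permutation_is_id:
  fixes p :: "nat \<Rightarrow> nat"
  assumes p: "p permutes {1..n}"
    and mono: "\<And>i j. i \<in> {1..n} \<Longrightarrow> j \<in> {1..n} \<Longrightarrow> i < j \<Longrightarrow> p i < p j"
  shows "p = id"
proof (rule permutes_natset_ge[OF p], rule ballI)
  fix i assume "i \<in> {1..n}"
  then show "i \<le> p i"
  proof (induction i)
    case (Suc i)
    show ?case
    proof (cases "i = 0")
      case True
      then show ?thesis using permutes_in_image[OF p, of "Suc i"] Suc.prems by auto
    next
      case False
      then have "i \<in> {1..n}" using Suc.prems by auto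
      then show ?thesis using Suc mono[of i "Suc i"] by fastforce
    qed
  qed simp
qed

text \<open>
  A strictly decreasing tuple is the only such tuple in its orbit under permutations of the indices, and
  its stabiliser is trivial: a permutation that relates two of them preserves the order of the indices.
\<close>

lemma decreasing_tuple_permute_eq:
  assumes k: "k \<in> decreasing_tuples n X" and l: "l \<in> decreasing_tuples n X"
    and p: "p permutes {1..n}" and eq: "\<And>i. i \<in> {1..n} \<Longrightarrow> k (p i) = l i"
  shows "p = id" and "k = l"
proof -
  show id: "p = id"
  proof (rule increasing_permutation_is_id[OF p])
    fix i j assume ij: "i \<in> {1..n}" "j \<in> {1..n}" "i < j"
    then have "k (p i) > k (p j)"
      using decreasing_tuples_less_iff[OF l] eq by auto
    moreover have "p i \<in> {1..n}" "p j \<in> {1..n}"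
      using ij permutes_in_image[OF p] by auto
    ultimately show "p i < p j"
      using decreasing_tuples_less_iff[OF k] by blast
  qed
  show "k = l"
    using k l eq unfolding id decreasing_tuples_def by (auto intro: PiE_ext)
qed

lemma obtain_decreasing_rearrangement:
  fixes r :: "nat \<Rightarrow> 'a::linorder"
  assumes r: "r \<in> {1..n} \<rightarrow>\<^sub>E X" and inj: "inj_on r {1..n}"
  obtains s q where "s \<in> decreasing_tuples n X" "q permutes {1..n}" "s \<circ> q = r"
proof -
  let ?S = "r ` {1..n}"
  define xs where "xs = rev (sorted_list_of_set ?S)"
  have len: "length xs = n" using inj by (simp add: xs_def card_image)
  have set_xs: "set xs = ?S" by (simp add: xs_def)
  have decr: "sorted_wrt (>) xs"
    unfolding xs_def sorted_wrt_rev by simp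
  have dist: "distinct xs" by (simp add: xs_def)
  define s where "s = (\<lambda>i\<in>{1..n}. xs ! (i - 1))"
  have s_in: "s i \<in> ?S" if "i \<in> {1..n}" for i
    using that nth_mem[of "i - 1" xs] set_xs len by (auto simp: s_def)
  have s: "s \<in> decreasing_tuples n X"
    unfolding decreasing_tuples_def
  proof (intro CollectI conjI ballI impI)
    show "s \<in> {1..n} \<rightarrow>\<^sub>E X" using s_in r by (fastforce simp: s_def)
    fix i j assume "i \<in> {1..n}" "j \<in> {1..n}" "i < j"
    then show "s i > s j"
      using sorted_wrt_nth_less[OF decr, of "i - 1" "j - 1"] len by (simp add: s_def)
  qed
  have s_inj: "inj_on s {1..n}" by (rule decreasing_tuples_inj_on[OF s])
  have "s ` {1..n} = ?S"
  proof (rule card_subset_eq)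
    show "s ` {1..n} \<subseteq> ?S" using s_in by blast
  qed (simp_all only: card_image[OF s_inj] card_image[OF inj] finite_imageI finite_atLeastAtMost)
  with s_inj have s_bij: "bij_betw s {1..n} ?S" by (simp add: bij_betw_def)
  define q where "q i = (if i \<in> {1..n} then inv_into {1..n} s (r i) else i)" for i
  have "bij_betw (inv_into {1..n} s \<circ> r) {1..n} {1..n}"
    by (rule bij_betw_trans[OF inj_on_imp_bij_betw[OF inj] bij_betw_inv_into[OF s_bij]])
  then have "bij_betw q {1..n} {1..n}"
    by (rule bij_betw_cong[THEN iffD1, rotated]) (simp add: q_def)
  then have q: "q permutes {1..n}"
    by (rule bij_imp_permutes) (simp only: q_def if_False)
  have "s (q i) = r i" for i
  proof (cases "i \<in> {1..n}")
    case True
    then show ?thesis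
      using bij_betw_inv_into_right[OF s_bij, of "r i"] by (simp add: q_def)
  next
    case False
    then show ?thesis using r by (auto simp: q_def s_def PiE_def extensional_def)
  qed
  then show thesis using that[OF s q] by (auto simp: o_def)
qed

text \<open>
  The strictly decreasing tuples are thus representatives of the free orbits, which turns a sum over
  decreasing tuples and permutations into a sum over all tuples without repeated entries.
\<close>

lemma bij_betw_decreasing_permutation:
  "bij_betw (\<lambda>(s, q). s \<circ> q) (decreasing_tuples n X \<times> {q. q permutes {1..n}})
     {r \<in> {1..n} \<rightarrow>\<^sub>E X. inj_on r {1..n}}"
proof (rule bij_betw_imageI)
  show "inj_on (\<lambda>(s, q). s \<circ> q) (decreasing_tuples n X \<times> {q. q permutes {1..n}})"
  proof (rule inj_onI, elim SigmaE, hypsubst, unfold mem_Collect_eq prod.case)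
    fix s q s' q'
    assume s: "s \<in> decreasing_tuples n X" "s' \<in> decreasing_tuples n X"
      and q: "q permutes {1..n}" and q': "q' permutes {1..n}" and eq: "s \<circ> q = s' \<circ> q'"
    have p: "q \<circ> inv q' permutes {1..n}"
      by (intro permutes_compose permutes_inv q q')
    have "s ((q \<circ> inv q') i) = s' i" for i
      using fun_cong[OF eq, of "inv q' i"] permutes_inverses[OF q'] by simp
    note * = decreasing_tuple_permute_eq[OF s p this]
    have "q = (q \<circ> inv q') \<circ> q'" using permutes_inv_o[OF q'] by (simp add: comp_assoc)
    also have "\<dots> = q'" unfolding *(1) by simp
    finally show "(s, q) = (s', q')" using *(2) by simp
  qed
  show "(\<lambda>(s, q). s \<circ> q) ` (decreasing_tuples n X \<times> {q. q permutes {1..n}})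
      = {r \<in> {1..n} \<rightarrow>\<^sub>E X. inj_on r {1..n}}"
  proof (intro equalityI subsetI)
    fix r assume "r \<in> {r \<in> {1..n} \<rightarrow>\<^sub>E X. inj_on r {1..n}}"
    then obtain s q where "s \<in> decreasing_tuples n X" "q permutes {1..n}" "s \<circ> q = r"
      using obtain_decreasing_rearrangement[of r n X] by blast
    then show "r \<in> (\<lambda>(s, q). s \<circ> q) ` (decreasing_tuples n X \<times> {q. q permutes {1..n}})"
      by force
  next
    fix r assume "r \<in> (\<lambda>(s, q). s \<circ> q) ` (decreasing_tuples n X \<times> {q. q permutes {1..n}})"
    then obtain s q where s: "s \<in> decreasing_tuples n X" and q: "q permutes {1..n}"
      and r: "r = s \<circ> q" by auto
    have sPi: "s \<in> {1..n} \<rightarrow>\<^sub>E X" using s by (simp add: decreasing_tuples_def)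
    have "r i \<in> X" if "i \<in> {1..n}" for i
      using sPi permutes_in_image[OF q, of i] that by (auto simp: r)
    moreover have "r i = undefined" if "i \<notin> {1..n}" for i
      using sPi that permutes_not_in[OF q that] by (auto simp: r PiE_def extensional_def)
    ultimately have "r \<in> {1..n} \<rightarrow>\<^sub>E X" by blast
    moreover have "inj_on r {1..n}"
      unfolding r using decreasing_tuples_inj_on[OF s] permutes_inj_on[OF q] permutes_image[OF q]
      by (intro comp_inj_on) auto
    ultimately show "r \<in> {r \<in> {1..n} \<rightarrow>\<^sub>E X. inj_on r {1..n}}" by simp
  qed
qed

section \<open>The Cauchy--Binet formula and its orthogonality consequence\<close>

text \<open>
  Expand only the second determinant. The remaining factors, weight and first determinant, are invariant
  and alternating under permutations of \<open>r\<close>, so the sum over permutations unfolds the sum over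
  decreasing \<open>r\<close> to a sum over injective \<open>r\<close>. The first determinant vanishes at all other \<open>r\<close>, so the
  sum may be taken over the whole product set, where it factors into one-dimensional sums.
\<close>

theorem cauchy_binet_alternant:
  fixes X :: "'b::linorder set"
  assumes X: "finite X"
  shows "(\<Sum>r\<in>decreasing_tuples n X. (\<Prod>i=1..n. w (r i)) * alternant n E k r * alternant n F l r)
       = alternant n (\<lambda>a b. \<Sum>t\<in>X. w t * E a t * F b t) k l"
proof -
  let ?P = "{q. q permutes {1..n}}"
  let ?h = "\<lambda>r. (\<Prod>i=1..n. w (r i)) * alternant n E k r * (\<Prod>i=1..n. F (l i) (r i))"
  have orbit: "(\<Prod>i=1..n. w (s i)) * alternant n E k s * alternant n F l s
      = (\<Sum>q\<in>?P. ?h (s \<circ> q))" for s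
  proof -
    have "?h (s \<circ> q) = (\<Prod>i=1..n. w (s i)) * alternant n E k s
        * (of_int (sign q) * (\<Prod>i=1..n. F (l i) (s (q i))))" if q: "q permutes {1..n}" for q
    proof -
      have "(\<Prod>i=1..n. w ((s \<circ> q) i)) = (\<Prod>i=1..n. w (s i))"
        using prod.permute[OF q, of "\<lambda>i. w (s i)"] by (simp add: o_def)
      then show ?thesis
        by (simp only: alternant_permute_columns[OF q] o_apply mult_ac)
    qed
    then have "(\<Sum>q\<in>?P. ?h (s \<circ> q)) = (\<Prod>i=1..n. w (s i)) * alternant n E k s
        * alternant n (\<lambda>a b. F b a) s l"
      by (auto simp: alternant_def[of n "\<lambda>a b. F b a"] sum_distrib_left intro!: sum.cong)
    then show ?thesis by (simp add: alternant_transpose[of n F])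
  qed
  have "(\<Sum>r\<in>decreasing_tuples n X. (\<Prod>i=1..n. w (r i)) * alternant n E k r * alternant n F l r)
      = (\<Sum>(s, q)\<in>decreasing_tuples n X \<times> ?P. ?h (s \<circ> q))"
    unfolding orbit by (rule sum.cartesian_product)
  also have "\<dots> = (\<Sum>r\<in>{r \<in> {1..n} \<rightarrow>\<^sub>E X. inj_on r {1..n}}. ?h r)"
    by (subst sum.reindex_bij_betw[OF bij_betw_decreasing_permutation, symmetric])
       (simp add: case_prod_unfold)
  also have "\<dots> = (\<Sum>r\<in>{1..n} \<rightarrow>\<^sub>E X. ?h r)"
    by (rule sum.mono_neutral_left) (auto simp: finite_PiE X alternant_repeated_column)
  also have "\<dots> = (\<Sum>r\<in>{1..n} \<rightarrow>\<^sub>E X. \<Sum>p\<in>?P. of_int (sign p)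
      * (\<Prod>i=1..n. w (r i) * E (k (p i)) (r i) * F (l i) (r i)))"
    by (simp add: alternant_def prod.distrib sum_distrib_left sum_distrib_right mult_ac)
  also have "\<dots> = (\<Sum>p\<in>?P. of_int (sign p)
      * (\<Sum>r\<in>{1..n} \<rightarrow>\<^sub>E X. \<Prod>i=1..n. w (r i) * E (k (p i)) (r i) * F (l i) (r i)))"
    by (subst sum.swap) (simp add: sum_distrib_left)
  also have "\<dots> = alternant n (\<lambda>a b. \<Sum>t\<in>X. w t * E a t * F b t) k l"
    unfolding alternant_def by (subst prod_sum_PiE) (simp_all add: X)
  finally show ?thesis .
qed

lemma alternant_diagonal:
  assumes k: "k \<in> decreasing_tuples n X" and l: "l \<in> decreasing_tuples n X"
    and G: "\<And>a b. a \<in> X \<Longrightarrow> b \<in> X \<Longrightarrow> G a b = (if a = b then g a else 0)"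
  shows "alternant n G k l = (if k = l then \<Prod>i=1..n. g (k i) else 0)"
proof -
  have in_X: "k i \<in> X" "l i \<in> X" if "i \<in> {1..n}" for i
    using that k l by (auto simp: decreasing_tuples_def)
  have "of_int (sign p) * (\<Prod>i=1..n. G (k (p i)) (l i))
      = (if p = id \<and> k = l then \<Prod>i=1..n. g (k i) else 0)" if p: "p permutes {1..n}" for p
  proof (cases "\<forall>i\<in>{1..n}. k (p i) = l i")
    case True
    note * = decreasing_tuple_permute_eq[OF k l p bspec[OF True]]
    have "(\<Prod>i=1..n. G (k (p i)) (l i)) = (\<Prod>i=1..n. g (k i))"
      using * in_X by (intro prod.cong) (auto simp: G)
    with * show ?thesis by simp
  next
    case False
    then obtain i where i: "i \<in> {1..n}" "k (p i) \<noteq> l i" by blast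
    then have "G (k (p i)) (l i) = 0"
      using in_X permutes_in_image[OF p, of i] by (simp add: G)
    with i have "(\<Prod>i=1..n. G (k (p i)) (l i)) = 0" by (intro prod_zero) auto
    moreover have "\<not> (p = id \<and> k = l)" using i by auto
    ultimately show ?thesis by (simp only: if_False mult_zero_right)
  qed
  then have "alternant n G k l
      = (\<Sum>p | p permutes {1..n}. if p = id then (if k = l then \<Prod>i=1..n. g (k i) else 0) else 0)"
    unfolding alternant_def by (auto intro!: sum.cong)
  also have "\<dots> = (if k = l then \<Prod>i=1..n. g (k i) else 0)"
    by (subst sum.delta) (simp_all add: finite_permutations permutes_id)
  finally show ?thesis .
qed

theorem alternant_orthogonal:
  fixes X :: "'b::linorder set"
  assumes "finite X" and "k \<in> decreasing_tuples n Y" and "l \<in> decreasing_tuples n Y"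
    and "\<And>a b. a \<in> Y \<Longrightarrow> b \<in> Y \<Longrightarrow> (\<Sum>t\<in>X. w t * E a t * E b t) = (if a = b then g a else 0)"
  shows "(\<Sum>r\<in>decreasing_tuples n X. (\<Prod>i=1..n. w (r i)) * alternant n E k r * alternant n E l r)
       = (if k = l then \<Prod>i=1..n. g (k i) else 0)"
  unfolding cauchy_binet_alternant[OF assms(1)]
  by (rule alternant_diagonal[OF assms(2,3)]) (rule assms(4))

section \<open>One-dimensional orthogonality\<close>

lemma sin_half_mult_cos_sum:
  "2 * sin (x / 2) * (1 / 2 + (\<Sum>r=1..m. cos (real r * x))) = sin ((real m + 1 / 2) * x)"
proof (induction m)
  case (Suc m)
  have "2 * sin (x / 2) * cos (real (Suc m) * x)
      = sin ((real (Suc m) + 1 / 2) * x) - sin ((real m + 1 / 2) * x)"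
  proof -
    have "sin ((real (Suc m) + 1 / 2) * x) = sin (real (Suc m) * x + x / 2)"
      "sin ((real m + 1 / 2) * x) = sin (real (Suc m) * x - x / 2)"
      by (simp_all add: algebra_simps)
    then show ?thesis by (simp only: sin_add sin_diff) simp
  qed
  with Suc show ?case by (simp add: algebra_simps)
qed simp

lemma sin_half_mult_cos_midpoint_sum:
  "2 * sin (x / 2) * (\<Sum>k<m. cos ((real k + 1 / 2) * x)) = sin (real m * x)"
proof (induction m)
  case (Suc m)
  have "2 * sin (x / 2) * cos ((real m + 1 / 2) * x) = sin (real (Suc m) * x) - sin (real m * x)"
  proof -
    have "sin (real (Suc m) * x) = sin ((real m + 1 / 2) * x + x / 2)"
      "sin (real m * x) = sin ((real m + 1 / 2) * x - x / 2)"
      by (simp_all add: algebra_simps)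
    then show ?thesis by (simp only: sin_add sin_diff) simp
  qed
  with Suc show ?case by (simp add: algebra_simps)
qed simp

lemma sin_pi_frac_nonzero:
  fixes a M :: int
  assumes "M > 0" "\<not> M dvd a"
  shows "sin (pi * of_int a / of_int M) \<noteq> 0"
proof
  assume "sin (pi * of_int a / of_int M) = 0"
  then obtain i :: int where "pi * of_int a / of_int M = of_int i * pi"
    by (auto simp: sin_zero_iff_int2)
  then have "(of_int a :: real) = of_int (i * M)" using assms by (simp add: field_simps)
  then have "a = i * M" by linarith
  with assms show False by simp
qed

lemma sum_int_interval:
  "(\<Sum>t\<in>{0..int N - 1}. f t) = (\<Sum>t<N. f (int t))"
  by (rule sum.reindex_bij_witness[of _ int nat]) auto

text \<open>
  The weight \<open>1/2\<close> at \<open>t = 0\<close> makes this half of the sum of the cosine over a full period of \<open>2N - 1\<close>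
  points; in closed form it is the Dirichlet kernel, whose numerator is \<open>sin (a \<pi>)\<close> here.
\<close>

lemma weighted_sum_points:
  fixes a :: int
  assumes N: "N \<ge> 1"
  shows "(\<Sum>t\<in>{0..int N - 1}. c N t * cos (of_int t * (2 * pi * of_int a / (2 * real N - 1))))
       = (if (2 * int N - 1) dvd a then (2 * real N - 1) / 2 else 0)"
proof -
  obtain m where m: "N = Suc m" using N by (cases N) auto
  let ?M = "2 * real N - 1" and ?x = "2 * pi * of_int a / (2 * real N - 1)"
  have M: "?M > 0" using N by simp
  have "(\<Sum>t\<in>{0..int N - 1}. c N t * cos (of_int t * ?x))
      = (\<Sum>t<N. c N (int t) * cos (real t * ?x))"
    by (simp add: sum_int_interval)
  also have "\<dots> = 1 / 2 + (\<Sum>t<m. c N (int (Suc t)) * cos (real (Suc t) * ?x))"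
    unfolding m by (subst sum.lessThan_Suc_shift) (simp add: c_def)
  also have "(\<Sum>t<m. c N (int (Suc t)) * cos (real (Suc t) * ?x)) = (\<Sum>t<m. cos (real (Suc t) * ?x))"
    by (intro sum.cong) (auto simp: c_def m)
  also have "\<dots> = (\<Sum>r=1..m. cos (real r * ?x))"
    by (rule sum.reindex_bij_witness[of _ "\<lambda>r. r - 1" Suc]) auto
  finally have S: "(\<Sum>t\<in>{0..int N - 1}. c N t * cos (of_int t * ?x))
      = 1 / 2 + (\<Sum>r=1..m. cos (real r * ?x))" .
  show ?thesis
  proof (cases "(2 * int N - 1) dvd a")
    case True
    then obtain b where b: "a = (2 * int N - 1) * b" by auto
    have "?x = 2 * pi * of_int b" using M by (simp add: b)
    then have "cos (real r * ?x) = 1" for r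
      using cos_int_2pin[of "int r * b"] by (simp add: mult_ac)
    then show ?thesis unfolding S using True by (simp add: m field_simps)
  next
    case False
    have "sin (pi * of_int a / of_int (2 * int N - 1)) \<noteq> 0"
      by (rule sin_pi_frac_nonzero) (use N False in auto)
    moreover have "pi * of_int a / of_int (2 * int N - 1) = ?x / 2"
    proof -
      have "u * v / w = 2 * u * v / w / 2" for u v w :: real by simp
      from this[of pi "of_int a" "2 * real N - 1"] show ?thesis
        by (simp only: of_int_diff of_int_mult of_int_numeral of_int_of_nat_eq of_int_1)
    qed
    ultimately have nz: "sin (?x / 2) \<noteq> 0" by metis
    have "(real m + 1 / 2) * ?x = of_int a * pi" using M by (simp add: m field_simps)
    then have "sin ((real m + 1 / 2) * ?x) = 0" unfolding sin_zero_iff_int2 by blast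
    then have "1 / 2 + (\<Sum>r=1..m. cos (real r * ?x)) = 0"
      using sin_half_mult_cos_sum[of ?x m] nz by simp
    then show ?thesis unfolding S using False by simp
  qed
qed

text \<open>
  At the last frequency \<open>t = N - 1\<close> the angle is \<open>a \<pi>\<close>. This term is its own mirror image under
  \<open>t \<mapsto> 2N - 2 - t\<close>, whence the weight \<open>1/2\<close>: it cancels the boundary term of the telescoping sum.
  A bound on \<open>a\<close> replaces divisibility because the value at a nonzero multiple \<open>(2N - 1) b\<close> would carry
  the sign \<open>(-1)^b\<close>.
\<close>

lemma weighted_sum_frequencies:
  fixes a :: int
  assumes N: "N \<ge> 1" and a: "\<bar>a\<bar> < 2 * int N - 1"
  shows "(\<Sum>t\<in>{0..int N - 1}. c N (t + 1)
           * cos ((of_int t + 1 / 2) * (2 * pi * of_int a / (2 * real N - 1))))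
       = (if a = 0 then (2 * real N - 1) / 2 else 0)"
proof -
  obtain m where m: "N = Suc m" using N by (cases N) auto
  let ?M = "2 * real N - 1" and ?x = "2 * pi * of_int a / (2 * real N - 1)"
  have M: "?M > 0" using N by simp
  have "(\<Sum>t\<in>{0..int N - 1}. c N (t + 1) * cos ((of_int t + 1 / 2) * ?x))
      = (\<Sum>t<N. c N (int t + 1) * cos ((real t + 1 / 2) * ?x))"
    by (simp add: sum_int_interval)
  also have "\<dots> = (\<Sum>t<m. c N (int t + 1) * cos ((real t + 1 / 2) * ?x))
      + cos ((real m + 1 / 2) * ?x) / 2"
    unfolding m by (subst sum.lessThan_Suc) (simp add: c_def)
  also have "(\<Sum>t<m. c N (int t + 1) * cos ((real t + 1 / 2) * ?x))
      = (\<Sum>t<m. cos ((real t + 1 / 2) * ?x))"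
    by (intro sum.cong) (auto simp: c_def m)
  finally have S: "(\<Sum>t\<in>{0..int N - 1}. c N (t + 1) * cos ((of_int t + 1 / 2) * ?x))
      = (\<Sum>t<m. cos ((real t + 1 / 2) * ?x)) + cos ((real m + 1 / 2) * ?x) / 2" .
  show ?thesis
  proof (cases "a = 0")
    case True
    then show ?thesis unfolding S by (simp add: m field_simps)
  next
    case False
    have "\<not> (2 * int N - 1) dvd a"
      using a False zdvd_not_zless[of "\<bar>a\<bar>" "2 * int N - 1"] by simp
    then have "sin (pi * of_int a / of_int (2 * int N - 1)) \<noteq> 0"
      by (intro sin_pi_frac_nonzero) (use N in auto)
    moreover have "pi * of_int a / of_int (2 * int N - 1) = ?x / 2"
    proof -
      have "u * v / w = 2 * u * v / w / 2" for u v w :: real by simp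
      from this[of pi "of_int a" "2 * real N - 1"] show ?thesis
        by (simp only: of_int_diff of_int_mult of_int_numeral of_int_of_nat_eq of_int_1)
    qed
    ultimately have nz: "sin (?x / 2) \<noteq> 0" by metis
    have y: "(real m + 1 / 2) * ?x = of_int a * pi" using M by (simp add: m field_simps)
    have "u * v = (u + 1 / 2) * v - v / 2" for u v :: real by (simp add: algebra_simps)
    from this[of "real m" ?x] have "sin (real m * ?x) = sin (of_int a * pi - ?x / 2)"
      unfolding y by (rule arg_cong)
    also have "\<dots> = - cos (of_int a * pi) * sin (?x / 2)"
    proof -
      have "sin (of_int a * pi) = 0" unfolding sin_zero_iff_int2 by blast
      then show ?thesis by (simp add: sin_diff)
    qed
    finally have "2 * sin (?x / 2) * ((\<Sum>t<m. cos ((real t + 1 / 2) * ?x))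
        + cos (of_int a * pi) / 2) = 0"
      using sin_half_mult_cos_midpoint_sum[of ?x m] by (simp add: algebra_simps)
    then show ?thesis unfolding S y using nz False by simp
  qed
qed

definition cosine_kernel :: "nat \<Rightarrow> int \<Rightarrow> int \<Rightarrow> real" where
  "cosine_kernel N a r = cos (pi * (of_int a + 1 / 2) * (2 * of_int r / (2 * real N - 1)))"

text \<open>
  The sum of the frequency labels enters as \<open>a + b + 1\<close>, which is at most \<open>2N - 1\<close> with equality only at
  \<open>a = b = N - 1\<close>. There both cosine sums contribute, which doubles the norm and accounts for the
  factor \<open>inverse (c N (a + 1))\<close>.
\<close>

lemma cosine_kernel_orthogonal_frequencies:
  assumes N: "N \<ge> 1" and a: "a \<in> {0..int N - 1}" and b: "b \<in> {0..int N - 1}"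
  shows "(\<Sum>t\<in>{0..int N - 1}. c N t * cosine_kernel N a t * cosine_kernel N b t)
       = (if a = b then inverse (c N (a + 1)) * ((2 * real N - 1) / 4) else 0)"
proof -
  let ?M = "2 * int N - 1"
  let ?x = "\<lambda>a. 2 * pi * of_int a / (2 * real N - 1)"
  have arg: "p * (u + 1 / 2) * (2 * t / m) - p * (v + 1 / 2) * (2 * t / m) = t * (2 * p * (u - v) / m)"
    "p * (u + 1 / 2) * (2 * t / m) + p * (v + 1 / 2) * (2 * t / m) = t * (2 * p * (u + v + 1) / m)"
    for p u v t m :: real
    by (cases "m = 0"; simp add: field_simps)+
  have "c N t * cosine_kernel N a t * cosine_kernel N b t
      = (c N t * cos (of_int t * ?x (a - b)) + c N t * cos (of_int t * ?x (a + b + 1))) / 2" for t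
  proof -
    have "w * cos x * cos y = (w * cos (x - y) + w * cos (x + y)) / 2" for w x y :: real
      by (simp add: mult.assoc cos_times_cos distrib_left)
    then show ?thesis
      by (simp only: cosine_kernel_def arg of_int_add of_int_diff of_int_1)
  qed
  then have "(\<Sum>t\<in>{0..int N - 1}. c N t * cosine_kernel N a t * cosine_kernel N b t)
      = ((if ?M dvd a - b then (2 * real N - 1) / 2 else 0)
        + (if ?M dvd a + b + 1 then (2 * real N - 1) / 2 else 0)) / 2"
    by (simp only: sum_divide_distrib[symmetric] sum.distrib weighted_sum_points[OF N])
  moreover have "?M dvd a - b \<longleftrightarrow> a = b"
    using a b dvd_imp_le_int[of "a - b" ?M] by force
  moreover have "?M dvd a + b + 1 \<longleftrightarrow> a = int N - 1 \<and> b = int N - 1"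
    using a b zdvd_imp_le[of ?M "a + b + 1"] by auto
  ultimately show ?thesis using a b by (auto simp: c_def)
qed

text \<open>Here the doubled norm occurs at \<open>r = s = 0\<close>, the only place where \<open>r + s\<close> vanishes.\<close>

lemma cosine_kernel_orthogonal_points:
  assumes N: "N \<ge> 1" and r: "r \<in> {0..int N - 1}" and s: "s \<in> {0..int N - 1}"
  shows "(\<Sum>t\<in>{0..int N - 1}. c N (t + 1) * cosine_kernel N t r * cosine_kernel N t s)
       = (if r = s then inverse (c N r) * ((2 * real N - 1) / 4) else 0)"
proof -
  let ?x = "\<lambda>a. 2 * pi * of_int a / (2 * real N - 1)"
  have arg: "p * (t + 1 / 2) * (2 * u / m) - p * (t + 1 / 2) * (2 * v / m) = (t + 1 / 2) * (2 * p * (u - v) / m)"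
    "p * (t + 1 / 2) * (2 * u / m) + p * (t + 1 / 2) * (2 * v / m) = (t + 1 / 2) * (2 * p * (u + v) / m)"
    for p u v t m :: real
    by (cases "m = 0"; simp add: field_simps)+
  have "c N (t + 1) * cosine_kernel N t r * cosine_kernel N t s
      = (c N (t + 1) * cos ((of_int t + 1 / 2) * ?x (r - s))
        + c N (t + 1) * cos ((of_int t + 1 / 2) * ?x (r + s))) / 2" for t
  proof -
    have "w * cos x * cos y = (w * cos (x - y) + w * cos (x + y)) / 2" for w x y :: real
      by (simp add: mult.assoc cos_times_cos distrib_left)
    then show ?thesis
      by (simp only: cosine_kernel_def arg of_int_add of_int_diff of_int_1)
  qed
  then have "(\<Sum>t\<in>{0..int N - 1}. c N (t + 1) * cosine_kernel N t r * cosine_kernel N t s)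
      = ((\<Sum>t\<in>{0..int N - 1}. c N (t + 1) * cos ((of_int t + 1 / 2) * ?x (r - s)))
        + (\<Sum>t\<in>{0..int N - 1}. c N (t + 1) * cos ((of_int t + 1 / 2) * ?x (r + s)))) / 2"
    by (simp only: sum_divide_distrib[symmetric] sum.distrib)
  also have "\<dots> = ((if r - s = 0 then (2 * real N - 1) / 2 else 0)
      + (if r + s = 0 then (2 * real N - 1) / 2 else 0)) / 2"
  proof -
    have "\<bar>r - s\<bar> < 2 * int N - 1" "\<bar>r + s\<bar> < 2 * int N - 1" using r s by auto
    from this[THEN weighted_sum_frequencies[OF N]] show ?thesis by (simp only:)
  qed
  finally show ?thesis using r s by (auto simp: c_def)
qed

section \<open>Orthogonality and expansion\<close>

lemma D_minus_eq: "D_minus n N = decreasing_tuples n {0..int N - 1}"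
  by (simp add: D_minus_def D_def decreasing_tuples_def)

lemma cos_minus_grid_point:
  "cos_minus n (plus_rho n k) (grid_point n N r) = alternant n (cosine_kernel N) k r"
proof -
  have "cos_minus n l x = alternant n (\<lambda>a b. cos (pi * a * b)) l x" for l x
    by (simp add: cos_minus_def alternant_def)
  then show ?thesis
    by (auto intro!: alternant_cong simp: cosine_kernel_def plus_rho_def \<rho>_def grid_point_def)
qed

lemma sum_grid:
  "(\<Sum>s\<in>F_VII_minus n N. h s) = (\<Sum>r\<in>D_minus n N. h (grid_point n N r))"
  unfolding F_VII_minus_def using sum.reindex[OF inj_on_grid_point] by simp

lemma prod_inverse_const:
  "(\<Prod>i=1..n. inverse (f i) * x) = inverse (\<Prod>i=1..n. f i) * x ^ n" for x :: real
  using prod_inversef[of f "{1..n}"] by (simp add: prod.distrib o_def)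

lemma cos_minus_orthogonal_frequencies:
  assumes N: "N \<ge> 1" and k: "k \<in> D_minus n N" and l: "l \<in> D_minus n N"
  shows "(\<Sum>s\<in>F_VII_minus n N.
            grid_weight n N s * cos_minus n (plus_rho n k) s * cos_minus n (plus_rho n l) s)
       = inverse (d_tilde n N k) * ((2 * real N - 1) / 4) ^ n * (if k = l then 1 else 0)"
proof -
  let ?X = "{0..int N - 1}"
  have "(\<Sum>s\<in>F_VII_minus n N.
            grid_weight n N s * cos_minus n (plus_rho n k) s * cos_minus n (plus_rho n l) s)
      = (\<Sum>r\<in>decreasing_tuples n ?X.
          (\<Prod>i=1..n. c N (r i)) * alternant n (cosine_kernel N) k r * alternant n (cosine_kernel N) l r)"
    unfolding sum_grid by (simp add: grid_weight_grid_point cos_minus_grid_point D_minus_eq)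
  also have "\<dots> = (if k = l
      then \<Prod>i=1..n. inverse (c N (k i + 1)) * ((2 * real N - 1) / 4) else 0)"
    using k l unfolding D_minus_eq
    by (intro alternant_orthogonal[where Y = ?X]) (simp, simp, simp, rule cosine_kernel_orthogonal_frequencies[OF N])
  finally show ?thesis by (simp only: prod_inverse_const d_tilde_def) simp
qed

text \<open>
  The alternant is unchanged when its kernel is transposed and its labellings are exchanged, so the
  grid labels can be treated as rows and the frequencies summed over as columns.
\<close>

lemma cos_minus_orthogonal_points:
  assumes N: "N \<ge> 1" and r: "r \<in> D_minus n N" and s: "s \<in> D_minus n N"
  shows "(\<Sum>k\<in>D_minus n N. d_tilde n N k * cos_minus n (plus_rho n k) (grid_point n N r)
            * cos_minus n (plus_rho n k) (grid_point n N s))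
       = inverse (\<Prod>i=1..n. c N (r i)) * ((2 * real N - 1) / 4) ^ n * (if r = s then 1 else 0)"
proof -
  let ?X = "{0..int N - 1}"
  have "(\<Sum>k\<in>D_minus n N. d_tilde n N k * cos_minus n (plus_rho n k) (grid_point n N r)
            * cos_minus n (plus_rho n k) (grid_point n N s))
      = (\<Sum>k\<in>decreasing_tuples n ?X. (\<Prod>i=1..n. c N (k i + 1))
          * alternant n (\<lambda>b a. cosine_kernel N a b) r k * alternant n (\<lambda>b a. cosine_kernel N a b) s k)"
    by (simp add: cos_minus_grid_point alternant_transpose[of n "cosine_kernel N"] D_minus_eq d_tilde_def)
  also have "\<dots> = (if r = s
      then \<Prod>i=1..n. inverse (c N (r i)) * ((2 * real N - 1) / 4) else 0)"
    using r s unfolding D_minus_eq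
    by (intro alternant_orthogonal[where w = "\<lambda>t. c N (t + 1)" and Y = ?X])
       (simp, simp, simp, rule cosine_kernel_orthogonal_points[OF N])
  finally show ?thesis by (simp only: prod_inverse_const) simp
qed

lemma amdct_expansion:
  assumes N: "N \<ge> 1" and s: "s \<in> F_VII_minus n N"
  shows "f s = (\<Sum>k\<in>D_minus n N. amdct_coeff n N f k * cos_minus n (plus_rho n k) s)"
proof -
  obtain q where q: "q \<in> D_minus n N" and s_eq: "s = grid_point n N q"
    using s by (auto simp: F_VII_minus_def)
  let ?g = "grid_point n N" and ?A = "\<lambda>k. cos_minus n (plus_rho n k)"
  let ?e = "\<lambda>r. \<Prod>i=1..n. c N (r i)" and ?C = "(2 * real N - 1) / 4"
  have nz: "?e r \<noteq> 0" for r by (simp add: c_def)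
  have C: "(4 / (2 * real N - 1)) ^ n * ?C ^ n = 1"
    using N by (simp add: flip: power_mult_distrib)
  have "(\<Sum>k\<in>D_minus n N. amdct_coeff n N f k * ?A k s)
      = (\<Sum>k\<in>D_minus n N. \<Sum>r\<in>D_minus n N. (4 / (2 * real N - 1)) ^ n * ?e r * f (?g r)
          * (d_tilde n N k * ?A k (?g r) * ?A k (?g q)))"
    unfolding amdct_coeff_def sum_grid s_eq sum_distrib_left sum_distrib_right
    by (intro sum.cong refl) (simp add: grid_weight_grid_point mult_ac)
  also have "\<dots> = (\<Sum>r\<in>D_minus n N. (4 / (2 * real N - 1)) ^ n * ?e r * f (?g r)
      * (\<Sum>k\<in>D_minus n N. d_tilde n N k * ?A k (?g r) * ?A k (?g q)))"
    by (subst sum.swap) (simp add: sum_distrib_left)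
  also have "\<dots> = (\<Sum>r\<in>D_minus n N. if r = q then f (?g r) else 0)"
  proof (intro sum.cong refl)
    fix r assume r: "r \<in> D_minus n N"
    have "(4 / (2 * real N - 1)) ^ n * ?e r * f (?g r) * (inverse (?e r) * ?C ^ n * d)
        = ((4 / (2 * real N - 1)) ^ n * ?C ^ n) * (?e r * inverse (?e r)) * f (?g r) * d" for d
      by (simp only: mult_ac)
    then show "(4 / (2 * real N - 1)) ^ n * ?e r * f (?g r)
      * (\<Sum>k\<in>D_minus n N. d_tilde n N k * ?A k (?g r) * ?A k (?g q)) = (if r = q then f (?g r) else 0)"
      unfolding cos_minus_orthogonal_points[OF N r q] C by (simp only: right_inverse[OF nz]) simp
  qed
  also have "\<dots> = f s" using q by (simp add: finite_D_minus s_eq)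
  finally show ?thesis by simp
qed

theorem mainTheorem3:
  fixes n N :: nat
  assumes "n \<ge> 1" and "N \<ge> 1"
  shows "(\<forall>k\<in>D_minus n N. \<forall>k'\<in>D_minus n N.
            (\<Sum>s\<in>F_VII_minus n N.
               grid_weight n N s * cos_minus n (plus_rho n k) s * cos_minus n (plus_rho n k') s)
            = inverse (d_tilde n N k) * ((2 * real N - 1) / 4) ^ n * (if k = k' then 1 else 0))
       \<and> (\<forall>f :: (nat \<Rightarrow> real) \<Rightarrow> real. \<forall>s\<in>F_VII_minus n N.
            f s = (\<Sum>k\<in>D_minus n N. amdct_coeff n N f k * cos_minus n (plus_rho n k) s))"
  using cos_minus_orthogonal_frequencies[OF assms(2)] amdct_expansion[OF assms(2)] by blast

end
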